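(* The following decision problem is undecidable. Input: a valid signature $\Sigma$, two types $A$ and $B$ such that $m,n\,;\,\top \vdash_\Sigma A\ \mathit{valid}$ and $m,n\,;\,\top \vdash_\Sigma B\ \mathit{valid}$ (so $A$ and $B$ have free arithmetic variables among $m,n$), and concrete natural numbers $i,j\in\mathbb{N}$. Question: does $A[i/m,j/n]\equiv B[i/m,j/n]$ hold (type equality with respect to $\Sigma$)?
   Context: **Syntax.** Arithmetic variables $n,m,k,\dots$ range over natural numbers; arithmetic expressions are evaluated in the integers; $i$ denotes a constant. - Arithmetic expressions: $e ::= i \mid e+e \mid e-e \mid i\times e \mid n$. - Arithmetic propositions (Presburger arithmetic): $\phi ::= e=e \mid e>e \mid (i \mid e) \mid \top \mid \bot \mid \phi\land\phi \mid \phi\lor\phi \mid \lnot\phi \mid \exists n.\,\phi \mid \forall n.\,\phi$, where $(i\mid e)$ is divisibility by a constant (also $\ge,\le,<$ as abbreviations). - Types: $A,B ::= \oplus\{\ell:A_\ell\}_{\ell\in L} \mid \&\{\ell:A_\ell\}_{\ell\in L} \mid A\otimes B \mid A\multimap B \mid \mathbf{1} \mid {?}\{\phi\}.\,A \mid {!}\{\phi\}.\,A \mid \exists n.\,A \mid \forall n.\,A \mid V[\overline e]$, where $L$ is a finite nonempty set of labels, $V$ is a type variable (type name) and $\overline e$ a (possibly empty) sequence of arithmetic expressions. $\exists n.A$ and $\forall n.A$ bind $n$ in $A$; bound variables may be silently renamed. - Signatures: finite lists $\Sigma$ of definitions $V[\overline n\mid\phi]=A$, with distinct defined type variables $V$;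 definitions may be mutually recursive. $V[\overline n]=A$ abbreviates $V[\overline n\mid \overline n\ge 0]=A$. A closed index expression is identified with its integer value. **Validity.** $\mathcal V;\mathcal C\models\phi$ means that $\forall\mathcal V.\,(\mathcal C\supset\phi)$ is true in arithmetic; $\models\phi$ abbreviates $\cdot\,;\top\models\phi$. The judgment $\mathcal V;\mathcal C\vdash_\Sigma A\ \mathit{valid}$ ($\mathcal V$ a finite collection of arithmetic variables containing all free variables of the proposition $\mathcal C$ and of $A$) is defined inductively: ${?}\{\phi\}.A$ and ${!}\{\phi\}.A$ are valid under $\mathcal V;\mathcal C$ if $A$ is valid under $\mathcal V;\mathcal C\land\phi$; $\exists n.A$ and $\forall n.A$ are valid under $\mathcal V;\mathcal C$ if $A$ is valid under $\mathcal V,n;\mathcal C$ ($n$ fresh); $V[\overline e]$ is valid under $\mathcal V;\mathcal C$ if $V[\overline n\mid\phi]=A\in\Sigma$ for some $A$ and $\mathcal V;\mathcal C\models\phi[\overline e/\overline n]$; $\mathbf 1$ is valid; and types built with $\oplus,\&,\otimes,\multimap$ are valid under $\mathcal V;\mathcal C$ if all their immediate components are. A signature $\Sigma$ is valid if for every definition $V[\overline n\mid\phi]=A$ in $\Sigma$, $A$ is not itself of the form $V'[\overline{e}']$ (contractiveness) and $\overline n;\phi\vdash_\Sigma A\ \mathit{valid}$. **Type equality.** A type is closed if it has no free arithmetic variables; closed valid types are those with $\cdot\,;\top\vdash_\Sigma A\ \mathit{valid}$. Define $\mathrm{unfold}_\Sigma(V[\overline e])=A[\overline e/\overline n]$ if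 $V[\overline n\mid\phi]=A\in\Sigma$, and $\mathrm{unfold}_\Sigma(A)=A$ if $A$ is not of the form $V[\overline e]$. A relation $\mathcal R$ on closed valid types is a type bisimulation if $(A,B)\in\mathcal R$ implies, for $S=\mathrm{unfold}_\Sigma(A)$ and $T=\mathrm{unfold}_\Sigma(B)$: - if $S=\oplus\{\ell:A_\ell\}_{\ell\in L}$ then $T=\oplus\{\ell:B_\ell\}_{\ell\in L}$ (same $L$) and $(A_\ell,B_\ell)\in\mathcal R$ for all $\ell\in L$; likewise with $\&$ in place of $\oplus$; - if $S=A_1\otimes A_2$ then $T=B_1\otimes B_2$ with $(A_1,B_1),(A_2,B_2)\in\mathcal R$; likewise with $\multimap$ in place of $\otimes$; - if $S=\mathbf 1$ then $T=\mathbf 1$; - if $S={?}\{\phi\}.A'$ then $T={?}\{\psi\}.B'$ and either (i) $\models\phi$, $\models\psi$ and $(A',B')\in\mathcal R$, or (ii) $\models\lnot\phi$ and $\models\lnot\psi$; likewise with ${!}$ in place of ${?}$; - if $S=\exists m.A'$ then $T=\exists n.B'$ and $(A'[i/m],B'[i/n])\in\mathcal R$ for all $i\in\mathbb N$; likewise with $\forall$ in place of $\exists$. For closed valid types, $A\equiv B$ means that there is a type bisimulation $\mathcal R$ with $(A,B)\in\mathcal R$. *)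

theory Defs
  imports Main "HOL-Library.Nat_Bijection"
begin

section \<open>Syntax\<close>

text \<open>
  Arithmetic variables are de Bruijn indices, so types and propositions are taken up to renaming
  of bound variables.  A variable context with \<open>k\<close> variables is represented by the number \<open>k\<close>; its
  variables are the indices below \<open>k\<close>.
\<close>

datatype aexp =
    Const int
  | Add aexp aexp
  | Sub aexp aexp
  | Scale int aexp
  | Var nat

datatype aprop =
    Eq aexp aexp
  | Gt aexp aexp
  | Dvd int aexp
  | Tru
  | Fls
  | And aprop aprop
  | Or aprop aprop
  | Neg aprop
  | Ex aprop
  | All aprop

type_synonym label = nat
type_synonym tname = nat

text \<open>
  A label-indexed family is an association list; the judgment \<open>valid\<close> below requires it
  to be nonempty with distinct labels, and type equality ignores the order of its entries.
  \<open>Assert\<close> is \<open>?{\<phi>}. A\<close> and \<open>Assume\<close> is \<open>!{\<phi>}. A\<close>.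
\<close>

datatype stype =
    Plus "(label \<times> stype) list"
  | With "(label \<times> stype) list"
  | Tensor stype stype
  | Lolli stype stype
  | One
  | Assert aprop stype
  | Assume aprop stype
  | ExT stype
  | AllT stype
  | Name tname "aexp list"

text \<open>
  \<open>Def V k \<phi> A\<close> is the definition \<open>V[n\<^sub>0, \<dots>, n\<^sub>k\<^sub>-\<^sub>1 | \<phi>] = A\<close>, where parameter \<open>n\<^sub>p\<close> is
  the index \<open>p\<close> in \<open>\<phi>\<close> and \<open>A\<close>.
\<close>

datatype tdef = Def (def_name: tname) (def_arity: nat) (def_guard: aprop) (def_body: stype)

type_synonym sig = "tdef list"


section \<open>Free variables and substitution\<close>

primrec scoped_exp :: "nat \<Rightarrow> aexp \<Rightarrow> bool" where
  "scoped_exp k (Const i) = True"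
| "scoped_exp k (Add e f) = (scoped_exp k e \<and> scoped_exp k f)"
| "scoped_exp k (Sub e f) = (scoped_exp k e \<and> scoped_exp k f)"
| "scoped_exp k (Scale i e) = scoped_exp k e"
| "scoped_exp k (Var n) = (n < k)"

fun scoped_prop :: "nat \<Rightarrow> aprop \<Rightarrow> bool" where
  "scoped_prop k (Eq e f) = (scoped_exp k e \<and> scoped_exp k f)"
| "scoped_prop k (Gt e f) = (scoped_exp k e \<and> scoped_exp k f)"
| "scoped_prop k (Dvd i e) = scoped_exp k e"
| "scoped_prop k Tru = True"
| "scoped_prop k Fls = True"
| "scoped_prop k (And p q) = (scoped_prop k p \<and> scoped_prop k q)"
| "scoped_prop k (Or p q) = (scoped_prop k p \<and> scoped_prop k q)"
| "scoped_prop k (Neg p) = scoped_prop k p"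
| "scoped_prop k (Ex p) = scoped_prop (Suc k) p"
| "scoped_prop k (All p) = scoped_prop (Suc k) p"

primrec subst_exp :: "(nat \<Rightarrow> aexp) \<Rightarrow> aexp \<Rightarrow> aexp" where
  "subst_exp \<sigma> (Const i) = Const i"
| "subst_exp \<sigma> (Add e f) = Add (subst_exp \<sigma> e) (subst_exp \<sigma> f)"
| "subst_exp \<sigma> (Sub e f) = Sub (subst_exp \<sigma> e) (subst_exp \<sigma> f)"
| "subst_exp \<sigma> (Scale i e) = Scale i (subst_exp \<sigma> e)"
| "subst_exp \<sigma> (Var n) = \<sigma> n"

definition shift :: "nat \<Rightarrow> aexp" where
  "shift n = Var (Suc n)"

definition under_binder :: "(nat \<Rightarrow> aexp) \<Rightarrow> nat \<Rightarrow> aexp" where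
  "under_binder \<sigma> n = (case n of 0 \<Rightarrow> Var 0 | Suc p \<Rightarrow> subst_exp shift (\<sigma> p))"

fun subst_prop :: "(nat \<Rightarrow> aexp) \<Rightarrow> aprop \<Rightarrow> aprop" where
  "subst_prop \<sigma> (Eq e f) = Eq (subst_exp \<sigma> e) (subst_exp \<sigma> f)"
| "subst_prop \<sigma> (Gt e f) = Gt (subst_exp \<sigma> e) (subst_exp \<sigma> f)"
| "subst_prop \<sigma> (Dvd i e) = Dvd i (subst_exp \<sigma> e)"
| "subst_prop \<sigma> Tru = Tru"
| "subst_prop \<sigma> Fls = Fls"
| "subst_prop \<sigma> (And p q) = And (subst_prop \<sigma> p) (subst_prop \<sigma> q)"
| "subst_prop \<sigma> (Or p q) = Or (subst_prop \<sigma> p) (subst_prop \<sigma> q)"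
| "subst_prop \<sigma> (Neg p) = Neg (subst_prop \<sigma> p)"
| "subst_prop \<sigma> (Ex p) = Ex (subst_prop (under_binder \<sigma>) p)"
| "subst_prop \<sigma> (All p) = All (subst_prop (under_binder \<sigma>) p)"

fun subst_type :: "(nat \<Rightarrow> aexp) \<Rightarrow> stype \<Rightarrow> stype" where
  "subst_type \<sigma> (Plus bs) = Plus (map (\<lambda>(l, A). (l, subst_type \<sigma> A)) bs)"
| "subst_type \<sigma> (With bs) = With (map (\<lambda>(l, A). (l, subst_type \<sigma> A)) bs)"
| "subst_type \<sigma> (Tensor A B) = Tensor (subst_type \<sigma> A) (subst_type \<sigma> B)"
| "subst_type \<sigma> (Lolli A B) = Lolli (subst_type \<sigma> A) (subst_type \<sigma> B)"
| "subst_type \<sigma> One = One"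
| "subst_type \<sigma> (Assert p A) = Assert (subst_prop \<sigma> p) (subst_type \<sigma> A)"
| "subst_type \<sigma> (Assume p A) = Assume (subst_prop \<sigma> p) (subst_type \<sigma> A)"
| "subst_type \<sigma> (ExT A) = ExT (subst_type (under_binder \<sigma>) A)"
| "subst_type \<sigma> (AllT A) = AllT (subst_type (under_binder \<sigma>) A)"
| "subst_type \<sigma> (Name V es) = Name V (map (subst_exp \<sigma>) es)"

text \<open>
  The simultaneous substitution of \<open>es\<close> for the first \<open>length es\<close> variables; the
  remaining variables are renumbered.
\<close>

definition inst :: "aexp list \<Rightarrow> nat \<Rightarrow> aexp" where
  "inst es n = (if n < length es then es ! n else Var (n - length es))"


section \<open>Semantics of arithmetic\<close>

primrec eval :: "(nat \<Rightarrow> nat) \<Rightarrow> aexp \<Rightarrow> int" where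
  "eval \<rho> (Const i) = i"
| "eval \<rho> (Add e f) = eval \<rho> e + eval \<rho> f"
| "eval \<rho> (Sub e f) = eval \<rho> e - eval \<rho> f"
| "eval \<rho> (Scale i e) = i * eval \<rho> e"
| "eval \<rho> (Var n) = int (\<rho> n)"

fun holds :: "(nat \<Rightarrow> nat) \<Rightarrow> aprop \<Rightarrow> bool" where
  "holds \<rho> (Eq e f) \<longleftrightarrow> eval \<rho> e = eval \<rho> f"
| "holds \<rho> (Gt e f) \<longleftrightarrow> eval \<rho> e > eval \<rho> f"
| "holds \<rho> (Dvd i e) \<longleftrightarrow> i dvd eval \<rho> e"
| "holds \<rho> Tru \<longleftrightarrow> True"
| "holds \<rho> Fls \<longleftrightarrow> False"
| "holds \<rho> (And p q) \<longleftrightarrow> holds \<rho> p \<and> holds \<rho> q"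
| "holds \<rho> (Or p q) \<longleftrightarrow> holds \<rho> p \<or> holds \<rho> q"
| "holds \<rho> (Neg p) \<longleftrightarrow> \<not> holds \<rho> p"
| "holds \<rho> (Ex p) \<longleftrightarrow> (\<exists>n. holds (case_nat n \<rho>) p)"
| "holds \<rho> (All p) \<longleftrightarrow> (\<forall>n. holds (case_nat n \<rho>) p)"

text \<open>
  The variable context of \<open>\<V>; \<C> \<Turnstile> \<phi>\<close> is omitted: variables not free in \<open>\<C>\<close> or \<open>\<phi>\<close> do not
  affect truth.
\<close>

definition entails :: "aprop \<Rightarrow> aprop \<Rightarrow> bool" where
  "entails C p \<longleftrightarrow> (\<forall>\<rho>. holds \<rho> C \<longrightarrow> holds \<rho> p)"


section \<open>Validity\<close>

text \<open>
  \<open>valid \<Sigma> k C A\<close> also checks that all free variables of \<open>A\<close> are below \<open>k\<close>, that name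
  applications have the right number of arguments, and that choices are indexed by
  a nonempty set of labels.
\<close>

inductive valid :: "sig \<Rightarrow> nat \<Rightarrow> aprop \<Rightarrow> stype \<Rightarrow> bool" for \<Sigma> :: sig where
  valid_Plus: "bs \<noteq> [] \<Longrightarrow> distinct (map fst bs) \<Longrightarrow>
    (\<And>l A. (l, A) \<in> set bs \<Longrightarrow> valid \<Sigma> k C A) \<Longrightarrow> valid \<Sigma> k C (Plus bs)"
| valid_With: "bs \<noteq> [] \<Longrightarrow> distinct (map fst bs) \<Longrightarrow>
    (\<And>l A. (l, A) \<in> set bs \<Longrightarrow> valid \<Sigma> k C A) \<Longrightarrow> valid \<Sigma> k C (With bs)"
| valid_Tensor: "valid \<Sigma> k C A \<Longrightarrow> valid \<Sigma> k C B \<Longrightarrow> valid \<Sigma> k C (Tensor A B)"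
| valid_Lolli: "valid \<Sigma> k C A \<Longrightarrow> valid \<Sigma> k C B \<Longrightarrow> valid \<Sigma> k C (Lolli A B)"
| valid_One: "valid \<Sigma> k C One"
| valid_Assert: "scoped_prop k p \<Longrightarrow> valid \<Sigma> k (And C p) A \<Longrightarrow> valid \<Sigma> k C (Assert p A)"
| valid_Assume: "scoped_prop k p \<Longrightarrow> valid \<Sigma> k (And C p) A \<Longrightarrow> valid \<Sigma> k C (Assume p A)"
| valid_ExT: "valid \<Sigma> (Suc k) (subst_prop shift C) A \<Longrightarrow> valid \<Sigma> k C (ExT A)"
| valid_AllT: "valid \<Sigma> (Suc k) (subst_prop shift C) A \<Longrightarrow> valid \<Sigma> k C (AllT A)"
| valid_Name: "Def V (length es) p A \<in> set \<Sigma> \<Longrightarrow> \<forall>e\<in>set es. scoped_exp k e \<Longrightarrow>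
    entails C (subst_prop (inst es) p) \<Longrightarrow> valid \<Sigma> k C (Name V es)"

abbreviation closed_valid :: "sig \<Rightarrow> stype \<Rightarrow> bool" where
  "closed_valid \<Sigma> A \<equiv> valid \<Sigma> 0 Tru A"

definition valid_sig :: "sig \<Rightarrow> bool" where
  "valid_sig \<Sigma> \<longleftrightarrow>
    distinct (map def_name \<Sigma>) \<and>
    (\<forall>V k p A. Def V k p A \<in> set \<Sigma> \<longrightarrow>
      (\<nexists>W es. A = Name W es) \<and> scoped_prop k p \<and> valid \<Sigma> k p A)"


section \<open>Type equality\<close>

fun unfold :: "sig \<Rightarrow> stype \<Rightarrow> stype" where
  "unfold \<Sigma> (Name V es) =
    (case find (\<lambda>d. def_name d = V) \<Sigma> of
      None \<Rightarrow> Name V es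
    | Some d \<Rightarrow> subst_type (inst es) (def_body d))"
| "unfold \<Sigma> A = A"

definition match_branches ::
    "(stype \<Rightarrow> stype \<Rightarrow> bool) \<Rightarrow> (label \<times> stype) list \<Rightarrow> (label \<times> stype) list \<Rightarrow> bool" where
  "match_branches R bs cs \<longleftrightarrow>
    fst ` set bs = fst ` set cs \<and>
    (\<forall>l A B. (l, A) \<in> set bs \<longrightarrow> (l, B) \<in> set cs \<longrightarrow> R A B)"

definition match_guarded ::
    "(stype \<Rightarrow> stype \<Rightarrow> bool) \<Rightarrow> aprop \<Rightarrow> stype \<Rightarrow> aprop \<Rightarrow> stype \<Rightarrow> bool" where
  "match_guarded R p A q B \<longleftrightarrow>
    entails Tru p \<and> entails Tru q \<and> R A B \<or>
    entails Tru (Neg p) \<and> entails Tru (Neg q)"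

definition match_quantified :: "(stype \<Rightarrow> stype \<Rightarrow> bool) \<Rightarrow> stype \<Rightarrow> stype \<Rightarrow> bool" where
  "match_quantified R A B \<longleftrightarrow>
    (\<forall>i::nat. R (subst_type (inst [Const (int i)]) A) (subst_type (inst [Const (int i)]) B))"

definition match_type :: "(stype \<Rightarrow> stype \<Rightarrow> bool) \<Rightarrow> stype \<Rightarrow> stype \<Rightarrow> bool" where
  "match_type R S T \<longleftrightarrow>
    (case S of
      Plus bs \<Rightarrow> \<exists>cs. T = Plus cs \<and> match_branches R bs cs
    | With bs \<Rightarrow> \<exists>cs. T = With cs \<and> match_branches R bs cs
    | Tensor A1 A2 \<Rightarrow> \<exists>B1 B2. T = Tensor B1 B2 \<and> R A1 B1 \<and> R A2 B2
    | Lolli A1 A2 \<Rightarrow> \<exists>B1 B2. T = Lolli B1 B2 \<and> R A1 B1 \<and> R A2 B2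
    | One \<Rightarrow> T = One
    | Assert p A \<Rightarrow> \<exists>q B. T = Assert q B \<and> match_guarded R p A q B
    | Assume p A \<Rightarrow> \<exists>q B. T = Assume q B \<and> match_guarded R p A q B
    | ExT A \<Rightarrow> \<exists>B. T = ExT B \<and> match_quantified R A B
    | AllT A \<Rightarrow> \<exists>B. T = AllT B \<and> match_quantified R A B
    | Name V es \<Rightarrow> True)"

text \<open>
  In a valid signature, the unfolding of a closed valid type is never a \<open>Name\<close>, so the last case
  of \<open>match_type\<close> does not arise.
\<close>

definition type_bisimulation :: "sig \<Rightarrow> (stype \<Rightarrow> stype \<Rightarrow> bool) \<Rightarrow> bool" where
  "type_bisimulation \<Sigma> R \<longleftrightarrow>
    (\<forall>A B. R A B \<longrightarrow>
      closed_valid \<Sigma> A \<and> closed_valid \<Sigma> B \<and> match_type R (unfold \<Sigma> A) (unfold \<Sigma> B))"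

definition type_eq :: "sig \<Rightarrow> stype \<Rightarrow> stype \<Rightarrow> bool" where
  "type_eq \<Sigma> A B \<longleftrightarrow> (\<exists>R. type_bisimulation \<Sigma> R \<and> R A B)"


section \<open>Decidability\<close>

text \<open>
  The model of computation is Minsky's register machine with finitely many instructions and
  unbounded registers.  \<open>Inc r q\<close> increments register \<open>r\<close> and goes to instruction \<open>q\<close>;
  \<open>Dec r q q'\<close> goes to \<open>q'\<close> if register \<open>r\<close> is zero, and otherwise decrements it and goes to \<open>q\<close>.
  A machine halts when it leaves its program.
\<close>

datatype instr = Inc nat nat | Dec nat nat nat

type_synonym program = "instr list"
type_synonym config = "nat \<times> (nat \<Rightarrow> nat)"

inductive rm_step :: "program \<Rightarrow> config \<Rightarrow> config \<Rightarrow> bool" for P :: program where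
  "pc < length P \<Longrightarrow> P ! pc = Inc r q \<Longrightarrow> rm_step P (pc, s) (q, s(r := s r + 1))"
| "pc < length P \<Longrightarrow> P ! pc = Dec r q q' \<Longrightarrow> s r > 0 \<Longrightarrow> rm_step P (pc, s) (q, s(r := s r - 1))"
| "pc < length P \<Longrightarrow> P ! pc = Dec r q q' \<Longrightarrow> s r = 0 \<Longrightarrow> rm_step P (pc, s) (q', s)"

definition rm_input :: "nat list \<Rightarrow> nat \<Rightarrow> nat" where
  "rm_input xs r = (if r < length xs then xs ! r else 0)"

definition rm_computes :: "program \<Rightarrow> nat list \<Rightarrow> nat \<Rightarrow> bool" where
  "rm_computes P xs y \<longleftrightarrow>
    (\<exists>pc s. (rm_step P)\<^sup>*\<^sup>* (0, rm_input xs) (pc, s) \<and> length P \<le> pc \<and> s 0 = y)"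

text \<open>
  A decision problem is given by its set of instances, the answer to be determined, and an encoding
  of instances by tuples of numbers.  The behaviour of a decision procedure on numbers that
  do not encode an instance is unconstrained.
\<close>

definition decidable :: "('a \<Rightarrow> nat list) \<Rightarrow> ('a \<Rightarrow> bool) \<Rightarrow> ('a \<Rightarrow> bool) \<Rightarrow> bool" where
  "decidable enc is_instance answer \<longleftrightarrow>
    (\<exists>P. \<forall>x. is_instance x \<longrightarrow> rm_computes P (enc x) (if answer x then 1 else 0))"


section \<open>Encoding of syntax by numbers\<close>

primrec enc_exp :: "aexp \<Rightarrow> nat" where
  "enc_exp (Const i) = list_encode [0, int_encode i]"
| "enc_exp (Add e f) = list_encode [1, enc_exp e, enc_exp f]"
| "enc_exp (Sub e f) = list_encode [2, enc_exp e, enc_exp f]"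
| "enc_exp (Scale i e) = list_encode [3, int_encode i, enc_exp e]"
| "enc_exp (Var n) = list_encode [4, n]"

primrec enc_prop :: "aprop \<Rightarrow> nat" where
  "enc_prop (Eq e f) = list_encode [0, enc_exp e, enc_exp f]"
| "enc_prop (Gt e f) = list_encode [1, enc_exp e, enc_exp f]"
| "enc_prop (Dvd i e) = list_encode [2, int_encode i, enc_exp e]"
| "enc_prop Tru = list_encode [3]"
| "enc_prop Fls = list_encode [4]"
| "enc_prop (And p q) = list_encode [5, enc_prop p, enc_prop q]"
| "enc_prop (Or p q) = list_encode [6, enc_prop p, enc_prop q]"
| "enc_prop (Neg p) = list_encode [7, enc_prop p]"
| "enc_prop (Ex p) = list_encode [8, enc_prop p]"
| "enc_prop (All p) = list_encode [9, enc_prop p]"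

fun enc_type :: "stype \<Rightarrow> nat" where
  "enc_type (Plus bs) = list_encode (0 # map (\<lambda>(l, A). prod_encode (l, enc_type A)) bs)"
| "enc_type (With bs) = list_encode (1 # map (\<lambda>(l, A). prod_encode (l, enc_type A)) bs)"
| "enc_type (Tensor A B) = list_encode [2, enc_type A, enc_type B]"
| "enc_type (Lolli A B) = list_encode [3, enc_type A, enc_type B]"
| "enc_type One = list_encode [4]"
| "enc_type (Assert p A) = list_encode [5, enc_prop p, enc_type A]"
| "enc_type (Assume p A) = list_encode [6, enc_prop p, enc_type A]"
| "enc_type (ExT A) = list_encode [7, enc_type A]"
| "enc_type (AllT A) = list_encode [8, enc_type A]"
| "enc_type (Name V es) = list_encode (9 # V # map enc_exp es)"

fun enc_def :: "tdef \<Rightarrow> nat" where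
  "enc_def (Def V k p A) = list_encode [V, k, enc_prop p, enc_type A]"

definition enc_sig :: "sig \<Rightarrow> nat" where
  "enc_sig \<Sigma> = list_encode (map enc_def \<Sigma>)"

lemma enc_exp_inject: "enc_exp e = enc_exp f \<longleftrightarrow> e = f"
  by (induction e arbitrary: f; case_tac f) (simp_all add: list_encode_eq int_encode_eq del: list_encode.simps)

lemma enc_prop_inject: "enc_prop p = enc_prop q \<longleftrightarrow> p = q"
  by (induction p arbitrary: q; case_tac q) (simp_all add: enc_exp_inject list_encode_eq int_encode_eq del: list_encode.simps)

lemma enc_branches_inject:
  assumes "\<And>l A C. (l, A) \<in> set bs \<Longrightarrow> enc_type A = enc_type C \<longleftrightarrow> A = C"
  shows "map (\<lambda>(l, A). prod_encode (l, enc_type A)) bs =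
         map (\<lambda>(l, A). prod_encode (l, enc_type A)) cs \<longleftrightarrow> bs = cs"
  using assms
proof (induction bs arbitrary: cs)
  case (Cons b bs)
  obtain l A where "b = (l, A)" by (cases b)
  moreover have "map (\<lambda>(l, A). prod_encode (l, enc_type A)) bs =
      map (\<lambda>(l, A). prod_encode (l, enc_type A)) ds \<longleftrightarrow> bs = ds" for ds
    using Cons.prems by (intro Cons.IH) auto
  ultimately show ?case
    using Cons.prems[of l A] by (cases cs) auto
qed auto

lemma enc_type_inject: "enc_type A = enc_type B \<longleftrightarrow> A = B"
proof (induction A arbitrary: B)
  case (Plus bs)
  then have "map (\<lambda>(l, A). prod_encode (l, enc_type A)) bs =
      map (\<lambda>(l, A). prod_encode (l, enc_type A)) cs \<longleftrightarrow> bs = cs" for cs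
    by (intro enc_branches_inject) fastforce
  then show ?case by (cases B) (simp_all add: list_encode_eq int_encode_eq del: list_encode.simps)
next
  case (With bs)
  then have "map (\<lambda>(l, A). prod_encode (l, enc_type A)) bs =
      map (\<lambda>(l, A). prod_encode (l, enc_type A)) cs \<longleftrightarrow> bs = cs" for cs
    by (intro enc_branches_inject) fastforce
  then show ?case by (cases B) (simp_all add: list_encode_eq int_encode_eq del: list_encode.simps)
next
  case (Name V es)
  have "map enc_exp es = map enc_exp fs \<longleftrightarrow> es = fs" for fs
    by (simp add: inj_map_eq_map inj_def enc_exp_inject)
  then show ?case by (cases B) (simp_all add: list_encode_eq int_encode_eq del: list_encode.simps)
qed (case_tac B; simp add: enc_prop_inject list_encode_eq del: list_encode.simps)+

lemma enc_sig_inject: "enc_sig \<Sigma> = enc_sig \<Sigma>' \<longleftrightarrow> \<Sigma> = \<Sigma>'"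
proof -
  have "enc_def d = enc_def d' \<longleftrightarrow> d = d'" for d d'
    by (cases d; cases d') (simp add: enc_prop_inject enc_type_inject list_encode_eq del: list_encode.simps)
  then show ?thesis
    by (simp add: enc_sig_def list_encode_eq inj_map_eq_map inj_def)
qed

end

theory Submission
  imports Defs
begin

text \<open>
  Direct diagonalisation, without a universal machine.  Let \<open>P\<close> be any register machine.  Each of its
  instructions becomes a type definition indexed by the register contents, so that unfolding a type
  is a step of \<open>P\<close>.  A further index, the flag, is passed along unchanged and inspected only
  after \<open>P\<close> has halted, by an assertion on which the flags 0 and 1 disagree iff the output is 1.  The
  initial definition takes indices \<open>i, j\<close> and starts \<open>P\<close> on \<open>(i, \<ulcorner>A\<urcorner>, \<ulcorner>B\<urcorner>, i, j)\<close>, where \<open>A\<close> and \<open>B\<close> are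
  its own instances with flags 0 and 1.  If \<open>P\<close> decided type equality, then for \<open>i\<close> the code of this
  very signature, it would output 1 iff \<open>A\<close> and \<open>B\<close> are equal iff it does not output 1.
\<close>

section \<open>Type equality as a greatest fixed point\<close>

lemma match_type_mono:
  assumes "match_type R S T" "\<And>A B. R A B \<Longrightarrow> R' A B"
  shows "match_type R' S T"
  using assms
  by (auto simp: match_type_def match_branches_def match_guarded_def match_quantified_def
      split: stype.splits)

text \<open>Matching is monotone, so the union of all bisimulations is again one; conversely, adding
  to it a single pair with matching unfoldings keeps it a bisimulation. Equality can thus be
  rewritten one unfolding at a time.\<close>

lemma type_eq_iff:
  "type_eq \<Sigma> A B \<longleftrightarrow> closed_valid \<Sigma> A \<and> closed_valid \<Sigma> B \<and>
    match_type (type_eq \<Sigma>) (unfold \<Sigma> A) (unfold \<Sigma> B)"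
proof
  assume "type_eq \<Sigma> A B"
  then obtain R where R: "type_bisimulation \<Sigma> R" "R A B" by (auto simp: type_eq_def)
  then have "match_type R (unfold \<Sigma> A) (unfold \<Sigma> B)" by (auto simp: type_bisimulation_def)
  then have "match_type (type_eq \<Sigma>) (unfold \<Sigma> A) (unfold \<Sigma> B)"
    by (rule match_type_mono) (use R(1) in \<open>auto simp: type_eq_def\<close>)
  then show "closed_valid \<Sigma> A \<and> closed_valid \<Sigma> B \<and>
      match_type (type_eq \<Sigma>) (unfold \<Sigma> A) (unfold \<Sigma> B)"
    using R by (auto simp: type_bisimulation_def)
next
  assume *: "closed_valid \<Sigma> A \<and> closed_valid \<Sigma> B \<and>
      match_type (type_eq \<Sigma>) (unfold \<Sigma> A) (unfold \<Sigma> B)"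
  define R where "R C D \<longleftrightarrow> type_eq \<Sigma> C D \<or> C = A \<and> D = B" for C D
  have "type_bisimulation \<Sigma> R"
    unfolding type_bisimulation_def
  proof (intro allI impI)
    fix C D
    assume "R C D"
    then consider S where "type_bisimulation \<Sigma> S" "S C D" | "C = A" "D = B"
      by (auto simp: R_def type_eq_def)
    then show "closed_valid \<Sigma> C \<and> closed_valid \<Sigma> D \<and> match_type R (unfold \<Sigma> C) (unfold \<Sigma> D)"
    proof cases
      case 1
      then have "closed_valid \<Sigma> C \<and> closed_valid \<Sigma> D \<and> match_type S (unfold \<Sigma> C) (unfold \<Sigma> D)"
        by (auto simp: type_bisimulation_def)
      moreover have "S E F \<Longrightarrow> R E F" for E F
        using 1 by (auto simp: R_def type_eq_def)
      ultimately show ?thesis using match_type_mono by blast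
    next
      case 2
      then show ?thesis using * match_type_mono[of "type_eq \<Sigma>" _ _ R] by (auto simp: R_def)
    qed
  qed
  then show "type_eq \<Sigma> A B" by (auto simp: type_eq_def R_def)
qed

lemma type_eq_Assert_true:
  assumes "closed_valid \<Sigma> (Assert p A)" "closed_valid \<Sigma> (Assert q B)"
    "entails Tru p" "entails Tru q"
  shows "type_eq \<Sigma> (Assert p A) (Assert q B) \<longleftrightarrow> type_eq \<Sigma> A B"
  using assms
  by (auto simp: type_eq_iff[of _ "Assert _ _"] match_type_def match_guarded_def entails_def)

text \<open>The continuations may differ arbitrarily: this discards the branch that the machine does
  not take.\<close>

lemma type_eq_Assert_false:
  assumes "closed_valid \<Sigma> (Assert p A)" "closed_valid \<Sigma> (Assert q B)"
    "entails Tru (Neg p)" "entails Tru (Neg q)"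
  shows "type_eq \<Sigma> (Assert p A) (Assert q B)"
  using assms
  by (auto simp: type_eq_iff[of _ "Assert _ _"] match_type_def match_guarded_def)


section \<open>The signature of a register machine\<close>

fun reg :: "instr \<Rightarrow> nat" where
  "reg (Inc r q) = r"
| "reg (Dec r q q') = r"

text \<open>Registers 0 to 4 receive the encoded instance. No instruction touches index
  \<open>k\<close>, which is therefore free to hold the flag.\<close>

locale machine =
  fixes P :: program and k :: nat
  assumes k_ge: "5 \<le> k"
    and reg_less: "\<And>i. i \<in> set P \<Longrightarrow> reg i < k"
begin

text \<open>
  A name below \<open>length P\<close> is a program position, \<open>length P\<close> stands for all positions outside the
  program, and \<open>Suc (length P)\<close> is the initial definition.  Parameter \<open>r < k\<close> is register \<open>r\<close>,
  and parameter \<open>k\<close> is the flag.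
\<close>

definition goto :: "nat \<Rightarrow> aexp list \<Rightarrow> stype" where
  "goto q es = Name (min q (length P)) es"

definition params :: "aexp list" where
  "params = map Var [0..<Suc k]"

definition start :: "int \<Rightarrow> stype" where
  "start c = Name (Suc (length P)) [Var 0, Var 1, Const c]"

text \<open>The code of the signature would be circular as a constant inside it, so it comes in
  through the index i. The two types mention only a name, so their codes can be constants.
  \<open>Var 0\<close> fills register 0 as the code and register 3 as the instance's own i;
  \<open>Var 2\<close> is the flag.\<close>

definition start_args :: "aexp list" where
  "start_args = [Var 0, Const (int (enc_type (start 0))), Const (int (enc_type (start 1))),
      Var 0, Var 1] @ replicate (k - 5) (Const 0) @ [Var 2]"

text \<open>\<open>Assert Tru\<close> serves contractiveness, since a body must not be a name. Types
  have no conditional, so a \<open>Dec\<close> offers both successors in a \<open>Tensor\<close>; on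
  register values exactly one guard holds.\<close>

definition body :: "nat \<Rightarrow> stype" where
  "body V =
    (if V < length P then
      (case P ! V of
        Inc r q \<Rightarrow> Assert Tru (goto q (params[r := Add (Var r) (Const 1)]))
      | Dec r q q' \<Rightarrow>
          Tensor (Assert (Gt (Var r) (Const 0)) (goto q (params[r := Sub (Var r) (Const 1)])))
                 (Assert (Eq (Var r) (Const 0)) (goto q' params)))
     else if V = length P then Assert (And (Eq (Var 0) (Const 1)) (Eq (Var k) (Const 0))) One
     else Assert Tru (goto 0 start_args))"

definition arity :: "nat \<Rightarrow> nat" where
  "arity V = (if V \<le> length P then Suc k else 3)"

definition machine_sig :: sig where
  "machine_sig = map (\<lambda>V. Def V (arity V) Tru (body V)) [0..<length P + 2]"

lemma Def_machine_sig:
  "Def V n p A \<in> set machine_sig \<longleftrightarrow>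
    V < length P + 2 \<and> n = arity V \<and> p = Tru \<and> A = body V"
  by (auto simp: machine_sig_def simp del: upt_Suc)

lemma valid_Name_machine:
  assumes "V < length P + 2" "length es = arity V" "\<forall>e\<in>set es. scoped_exp n e"
  shows "valid machine_sig n C (Name V es)"
  by (rule valid_Name[where p = Tru]) (use assms in \<open>auto simp: Def_machine_sig entails_def\<close>)

lemma valid_goto:
  assumes "length es = Suc k" "\<forall>e\<in>set es. scoped_exp n e"
  shows "valid machine_sig n C (goto q es)"
  unfolding goto_def by (rule valid_Name_machine) (use assms in \<open>auto simp: arity_def\<close>)

lemma valid_start: "valid machine_sig 2 Tru (start c)"
  unfolding start_def by (rule valid_Name_machine) (auto simp: arity_def)

lemma length_params [simp]: "length params = Suc k"
  by (simp add: params_def)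

lemma scoped_params_update:
  assumes "scoped_exp (Suc k) e"
  shows "\<forall>f\<in>set (params[r := e]). scoped_exp (Suc k) f"
proof
  fix f
  assume "f \<in> set (params[r := e])"
  then have "f \<in> insert e (set params)" using set_update_subset_insert by fast
  with assms show "scoped_exp (Suc k) f" by (auto simp: params_def)
qed

lemma length_start_args: "length start_args = Suc k"
  using k_ge by (simp add: start_args_def)

lemma valid_body:
  assumes "V < length P + 2"
  shows "valid machine_sig (arity V) Tru (body V)"
proof -
  consider "V < length P" | "V = length P" | "V = Suc (length P)" using assms by linarith
  then show ?thesis
  proof cases
    case 1
    then have r: "reg (P ! V) < k" by (simp add: reg_less)
    have params: "\<forall>f\<in>set params. scoped_exp (Suc k) f" by (auto simp: params_def)
    show ?thesis
    proof (cases "P ! V")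
      case (Inc r q)
      have "\<forall>f\<in>set (params[r := Add (Var r) (Const 1)]). scoped_exp (Suc k) f"
        by (rule scoped_params_update) (use Inc r in simp)
      then show ?thesis
        unfolding body_def arity_def using 1 Inc
        by (simp add: valid_Assert valid_goto)
    next
      case (Dec r q q')
      have "\<forall>f\<in>set (params[r := Sub (Var r) (Const 1)]). scoped_exp (Suc k) f"
        by (rule scoped_params_update) (use Dec r in simp)
      then show ?thesis
        unfolding body_def arity_def using 1 Dec r params
        by (simp add: valid_Tensor valid_Assert valid_goto)
    qed
  next
    case 2
    then show ?thesis
      unfolding body_def arity_def by (simp add: valid_Assert valid_One)
  next
    case 3
    have "\<forall>e\<in>set start_args. scoped_exp 3 e" by (auto simp: start_args_def)
    with 3 show ?thesis
      by (auto simp: body_def arity_def length_start_args intro!: valid_Assert valid_goto)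
  qed
qed

lemma valid_machine_sig: "valid_sig machine_sig"
proof -
  have "body V \<noteq> Name W es" for V W es
    by (auto simp: body_def split: instr.split)
  moreover have "map def_name machine_sig = [0..<length P + 2]"
    by (rule nth_equalityI) (auto simp: machine_sig_def simp del: upt_Suc)
  ultimately show ?thesis
    by (auto simp: valid_sig_def Def_machine_sig valid_body simp del: upt_Suc)
qed

lemma unfold_machine:
  assumes "V < length P + 2"
  shows "unfold machine_sig (Name V es) = subst_type (inst es) (body V)"
proof -
  have "find (\<lambda>d. def_name d = V) machine_sig = Some (Def V (arity V) Tru (body V))"
    unfolding find_Some_iff
    by (rule exI[of _ V]) (use assms in \<open>auto simp: machine_sig_def nth_append simp del: upt_Suc\<close>)
  then show ?thesis by simp
qed


section \<open>Simulation\<close>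

text \<open>Substitution does not evaluate, so arguments grow into nested sums and differences along
  a run; only their values are tied to the registers.\<close>

definition represents :: "aexp list \<Rightarrow> (nat \<Rightarrow> nat) \<Rightarrow> int \<Rightarrow> bool" where
  "represents es s c \<longleftrightarrow> length es = Suc k \<and> (\<forall>e\<in>set es. scoped_exp 0 e) \<and>
    (\<forall>\<rho>. (\<forall>r<k. eval \<rho> (es ! r) = int (s r)) \<and> eval \<rho> (es ! k) = c)"

lemma represents_update:
  assumes "represents es s c" "r < k" "scoped_exp 0 e" "\<And>\<rho>. eval \<rho> e = int n"
  shows "represents (es[r := e]) (s(r := n)) c"
proof -
  have "scoped_exp 0 f" if "f \<in> set (es[r := e])" for f
    using set_update_subset_insert that assms by (fastforce simp: represents_def)
  with assms show ?thesis by (auto simp: represents_def nth_list_update)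
qed

lemma closed_valid_goto: "represents es s c \<Longrightarrow> closed_valid machine_sig (goto q es)"
  by (rule valid_goto) (auto simp: represents_def)

lemma closed_valid_Assert_goto:
  "scoped_prop 0 p \<Longrightarrow> length es = Suc k \<Longrightarrow> \<forall>e\<in>set es. scoped_exp 0 e \<Longrightarrow>
    closed_valid machine_sig (Assert p (goto q es))"
  by (intro valid_Assert valid_goto)

lemma subst_params:
  assumes "length es = Suc k" "r < k"
  shows "map (subst_exp (inst es)) (params[r := e]) = es[r := subst_exp (inst es) e]"
    and "map (subst_exp (inst es)) params = es"
proof -
  show "map (subst_exp (inst es)) params = es"
    by (rule nth_equalityI) (use assms in \<open>auto simp: params_def inst_def simp del: upt_Suc\<close>)
  then show "map (subst_exp (inst es)) (params[r := e]) = es[r := subst_exp (inst es) e]"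
    by (simp add: map_update)
qed

lemma type_eq_goto_iff:
  assumes "represents es s 0" "represents fs s 1"
  shows "type_eq machine_sig (goto q es) (goto q fs) \<longleftrightarrow>
    match_type (type_eq machine_sig)
      (subst_type (inst es) (body (min q (length P))))
      (subst_type (inst fs) (body (min q (length P))))"
  using type_eq_iff[of machine_sig "goto q es" "goto q fs"] assms
  by (auto simp: closed_valid_goto goto_def[of q] unfold_machine simp del: unfold.simps
      dest: closed_valid_goto[of _ _ _ q])

lemma subst_goto: "subst_type \<sigma> (goto q es) = goto q (map (subst_exp \<sigma>) es)"
  by (simp add: goto_def)

text \<open>Both sides have the same register values, so their guards agree and only the successor
  actually taken matters. An equivalence is needed because the output may settle equality either
  way.\<close>

lemma type_eq_step:
  assumes "rm_step P (pc, s) (pc', s')" "represents es s 0" "represents fs s 1"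
  shows "\<exists>es' fs'. represents es' s' 0 \<and> represents fs' s' 1 \<and>
    (type_eq machine_sig (goto pc es) (goto pc fs) \<longleftrightarrow>
     type_eq machine_sig (goto pc' es') (goto pc' fs'))"
proof -
  have "pc < length P" using assms(1) by cases auto
  then have r: "reg (P ! pc) < k" and pc: "min pc (length P) = pc" by (auto simp: reg_less)
  have *: "length es = Suc k" "length fs = Suc k" using assms by (auto simp: represents_def)
  have scoped: "scoped_exp 0 (es ! r)" "scoped_exp 0 (fs ! r)" if "r < k" for r
    using assms(2,3) that by (auto simp: represents_def)
  have eval: "eval \<rho> (es ! r) = int (s r)" "eval \<rho> (fs ! r) = int (s r)" if "r < k" for r \<rho>
    using assms(2,3) that by (auto simp: represents_def)
  \<comment> \<open>For a zero register the decremented argument has value -1, so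
    \<open>represents\<close> fails for it; validity of that dead branch rests on scoping
    alone.\<close>
  have scoped_update: "scoped_exp 0 e"
    if "r < k" "e \<in> set (es[r := Sub (es ! r) (Const 1)]) \<union> set (fs[r := Sub (fs ! r) (Const 1)])"
    for r e
    using set_update_subset_insert[of es r] set_update_subset_insert[of fs r]
      scoped that assms(2,3) by (fastforce simp: represents_def)
  note unf = type_eq_goto_iff[OF assms(2,3), of pc, unfolded pc]
  consider r q where "P ! pc = Inc r q" "pc' = q" "s' = s(r := s r + 1)"
    | r q q' where "P ! pc = Dec r q q'" "0 < s r" "pc' = q" "s' = s(r := s r - 1)"
    | r q q' where "P ! pc = Dec r q q'" "s r = 0" "pc' = q'" "s' = s"
    using assms(1) by cases auto
  then show ?thesis
  proof cases
    case (1 r q)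
    let ?es = "es[r := Add (es ! r) (Const 1)]" and ?fs = "fs[r := Add (fs ! r) (Const 1)]"
    have r': "r < k" using r 1 by simp
    have rep: "represents ?es s' 0" "represents ?fs s' 1"
      unfolding 1 using assms r' scoped eval by (auto intro!: represents_update)
    have "type_eq machine_sig (goto pc es) (goto pc fs) \<longleftrightarrow>
        type_eq machine_sig (goto pc' ?es) (goto pc' ?fs)"
      unfolding unf using \<open>pc < length P\<close> 1 r' *
      by (simp add: body_def subst_goto subst_params inst_def match_type_def match_guarded_def
          entails_def)
    with rep show ?thesis by blast
  next
    case (2 r q q')
    let ?es = "es[r := Sub (es ! r) (Const 1)]" and ?fs = "fs[r := Sub (fs ! r) (Const 1)]"
    have r': "r < k" using r 2 by simp
    have rep: "represents ?es s' 0" "represents ?fs s' 1"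
      unfolding 2 using assms r' scoped eval 2 by (auto intro!: represents_update simp: of_nat_diff)
    have "type_eq machine_sig (goto pc es) (goto pc fs) \<longleftrightarrow>
        type_eq machine_sig (Assert (Gt (es ! r) (Const 0)) (goto pc' ?es))
          (Assert (Gt (fs ! r) (Const 0)) (goto pc' ?fs)) \<and>
        type_eq machine_sig (Assert (Eq (es ! r) (Const 0)) (goto q' es))
          (Assert (Eq (fs ! r) (Const 0)) (goto q' fs))"
      unfolding unf using \<open>pc < length P\<close> 2 r' *
      by (simp add: body_def subst_goto subst_params[where r = r] inst_def match_type_def)
    \<comment> \<open>The positivity guard holds on both sides and is stripped; the zero test fails
      on both sides, making that component equal for free.\<close>
    also have "\<dots> \<longleftrightarrow> type_eq machine_sig (goto pc' ?es) (goto pc' ?fs)"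
      using 2 r' eval scoped * scoped_update assms(2,3)
      by (simp add: type_eq_Assert_true type_eq_Assert_false entails_def represents_def
          closed_valid_Assert_goto)
    finally show ?thesis using rep by blast
  next
    case (3 r q q')
    have r': "r < k" using r 3 by simp
    have "type_eq machine_sig (goto pc es) (goto pc fs) \<longleftrightarrow>
        type_eq machine_sig
          (Assert (Gt (es ! r) (Const 0)) (goto q (es[r := Sub (es ! r) (Const 1)])))
          (Assert (Gt (fs ! r) (Const 0)) (goto q (fs[r := Sub (fs ! r) (Const 1)]))) \<and>
        type_eq machine_sig (Assert (Eq (es ! r) (Const 0)) (goto pc' es))
          (Assert (Eq (fs ! r) (Const 0)) (goto pc' fs))"
      unfolding unf using \<open>pc < length P\<close> 3 r' *
      by (simp add: body_def subst_goto subst_params[where r = r] inst_def match_type_def)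
    \<comment> \<open>The roles of the two guards are exchanged.\<close>
    also have "\<dots> \<longleftrightarrow> type_eq machine_sig (goto pc' es) (goto pc' fs)"
      using 3 r' eval scoped * scoped_update assms(2,3)
      by (simp add: type_eq_Assert_true type_eq_Assert_false entails_def represents_def
          closed_valid_Assert_goto)
    finally show ?thesis using assms(2,3) 3 by blast
  qed
qed

text \<open>With flag 1 the final guard is always false; with flag 0 it is true iff the output is 1.
  Two false guards match, whereas a true one never matches a false one.\<close>

lemma type_eq_halt:
  assumes "length P \<le> pc" "represents es s 0" "represents fs s 1"
  shows "type_eq machine_sig (goto pc es) (goto pc fs) \<longleftrightarrow> s 0 \<noteq> 1"
proof -
  have pc: "min pc (length P) = length P" using assms(1) by simp
  have "length es = Suc k" "length fs = Suc k" "0 < k"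
    using assms k_ge by (auto simp: represents_def)
  then have sub: "inst es 0 = es ! 0" "inst fs 0 = fs ! 0" "inst es k = es ! k" "inst fs k = fs ! k"
    by (auto simp: inst_def)
  have eval: "eval \<rho> (es ! 0) = int (s 0)" "eval \<rho> (fs ! 0) = int (s 0)"
    "eval \<rho> (es ! k) = 0" "eval \<rho> (fs ! k) = 1" for \<rho>
    using assms(2,3) k_ge by (auto simp: represents_def)
  show ?thesis
    unfolding type_eq_goto_iff[OF assms(2,3)] pc
    by (simp add: body_def sub eval match_type_def match_guarded_def entails_def)
qed

lemma type_eq_run:
  assumes "(rm_step P)\<^sup>*\<^sup>* (pc, s) (pc', s')" "length P \<le> pc'"
    "represents es s 0" "represents fs s 1"
  shows "type_eq machine_sig (goto pc es) (goto pc fs) \<longleftrightarrow> s' 0 \<noteq> 1"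
  using assms(1,3,4)
proof (induction "(pc, s)" arbitrary: pc s es fs rule: converse_rtranclp_induct)
  case base
  then show ?case using type_eq_halt assms(2) by blast
next
  case (step c)
  obtain pc1 s1 where c: "c = (pc1, s1)" by (cases c)
  show ?case using type_eq_step[OF step(1)[unfolded c] step(4,5)] step(3)[OF c] by blast
qed

section \<open>The initial configuration\<close>

definition initial_args :: "nat \<Rightarrow> nat \<Rightarrow> int \<Rightarrow> aexp list" where
  "initial_args i j c =
    map (subst_exp (inst [Const (int i), Const (int j), Const c])) start_args"

lemma represents_initial_args:
  "represents (initial_args i j c)
    (rm_input [i, enc_type (start 0), enc_type (start 1), i, j]) c"
proof -
  have "\<forall>e\<in>set (initial_args i j c). scoped_exp 0 e"
    by (auto simp: initial_args_def start_args_def inst_def)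
  moreover have "eval \<rho> (initial_args i j c ! r) =
      int (rm_input [i, enc_type (start 0), enc_type (start 1), i, j] r)" if "r < k" for \<rho> r
  \<comment> \<open>Below 5 lie the listed inputs; from 5 on, the zero padding agrees with the
    default of \<open>rm_input\<close>.\<close>
  proof (cases "r < 5")
    case True
    then show ?thesis
      by (auto simp: initial_args_def start_args_def inst_def rm_input_def less_Suc_eq numeral_eq_Suc)
  next
    case False
    with that show ?thesis
      by (auto simp: initial_args_def start_args_def inst_def rm_input_def nth_append nth_Cons'
          numeral_eq_Suc)
  qed
  moreover have "eval \<rho> (initial_args i j c ! k) = c" for \<rho>
    using k_ge by (auto simp: initial_args_def start_args_def inst_def nth_append nth_Cons'
      numeral_eq_Suc)
  ultimately show ?thesis
    by (simp add: represents_def initial_args_def length_start_args)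
qed

lemma type_eq_start:
  "type_eq machine_sig (subst_type (inst [Const (int i), Const (int j)]) (start 0))
      (subst_type (inst [Const (int i), Const (int j)]) (start 1)) \<longleftrightarrow>
    type_eq machine_sig (goto 0 (initial_args i j 0)) (goto 0 (initial_args i j 1))"
proof -
  have eq: "subst_type (inst [Const (int i), Const (int j)]) (start c) =
      Name (Suc (length P)) [Const (int i), Const (int j), Const c]" for c
    by (simp add: start_def inst_def)
  have valid: "closed_valid machine_sig
      (Name (Suc (length P)) [Const (int i), Const (int j), Const c])" for c
    by (rule valid_Name_machine) (auto simp: arity_def)
  have unfold: "unfold machine_sig (Name (Suc (length P)) [Const (int i), Const (int j), Const c]) =
      Assert Tru (goto 0 (initial_args i j c))" for c
    by (simp add: unfold_machine body_def subst_goto initial_args_def del: unfold.simps)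
  show ?thesis
    unfolding eq type_eq_iff[of _ "Name _ _"] unfold
    by (simp add: valid match_type_def match_guarded_def entails_def)
qed

lemma type_eq_start_iff:
  assumes "rm_computes P [i, enc_type (start 0), enc_type (start 1), i, j] y"
  shows "type_eq machine_sig (subst_type (inst [Const (int i), Const (int j)]) (start 0))
      (subst_type (inst [Const (int i), Const (int j)]) (start 1)) \<longleftrightarrow> y \<noteq> 1"
  using assms type_eq_run represents_initial_args unfolding type_eq_start rm_computes_def by blast

end

section \<open>The diagonal instance\<close>

theorem theorem14:
  "\<not> decidable
      (\<lambda>(\<Sigma> :: sig, A :: stype, B :: stype, i :: nat, j :: nat).
        [enc_sig \<Sigma>, enc_type A, enc_type B, i, j])
      (\<lambda>(\<Sigma>, A, B, i, j).
        valid_sig \<Sigma> \<and> valid \<Sigma> 2 Tru A \<and> valid \<Sigma> 2 Tru B)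
      (\<lambda>(\<Sigma>, A, B, i, j).
        type_eq \<Sigma> (subst_type (inst [Const (int i), Const (int j)]) A)
                  (subst_type (inst [Const (int i), Const (int j)]) B))"
proof
  assume "decidable
      (\<lambda>(\<Sigma> :: sig, A :: stype, B :: stype, i :: nat, j :: nat).
        [enc_sig \<Sigma>, enc_type A, enc_type B, i, j])
      (\<lambda>(\<Sigma>, A, B, i, j).
        valid_sig \<Sigma> \<and> valid \<Sigma> 2 Tru A \<and> valid \<Sigma> 2 Tru B)
      (\<lambda>(\<Sigma>, A, B, i, j).
        type_eq \<Sigma> (subst_type (inst [Const (int i), Const (int j)]) A)
                  (subst_type (inst [Const (int i), Const (int j)]) B))"
  then obtain P where P: "valid_sig \<Sigma> \<Longrightarrow> valid \<Sigma> 2 Tru A \<Longrightarrow> valid \<Sigma> 2 Tru B \<Longrightarrow>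
      rm_computes P [enc_sig \<Sigma>, enc_type A, enc_type B, i, j]
        (if type_eq \<Sigma> (subst_type (inst [Const (int i), Const (int j)]) A)
             (subst_type (inst [Const (int i), Const (int j)]) B) then 1 else 0)" for \<Sigma> A B i j
    unfolding decidable_def by fastforce
  \<comment> \<open>The sum of all register numbers in \<open>P\<close> bounds each of them.\<close>
  interpret machine P "5 + Suc (sum_list (map reg P))"
  proof
    show "reg x < 5 + Suc (sum_list (map reg P))" if "x \<in> set P" for x
      using member_le_sum_list[of "reg x" "map reg P"] that by simp
  qed simp
  \<comment> \<open>With this \<open>i\<close>, the true encoding of the instance coincides with the
    input on which the signature simulates \<open>P\<close>; the second index is set to 0
    arbitrarily.\<close>
  define i where "i = enc_sig machine_sig"
  show False
    using type_eq_start_iff[OF P[OF valid_machine_sig valid_start valid_start,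
          of 0 1 i 0, folded i_def]]
    by (auto split: if_splits)
qed

end
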